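(* Let $\mathcal{B}\subseteq\mathcal{A}$ be a unital inclusion of finite-dimensional $C^*$-algebras. The following conditions are equivalent: (i) $\mathcal{B}'\cap\mathcal{A}\subseteq\mathcal{B}$. (ii) There is a unique conditional expectation from $\mathcal{A}$ onto $\mathcal{B}$.
   Context: A unital inclusion means $\mathcal{B}$ is a $C^*$-subalgebra containing $1_{\mathcal{A}}$. $\mathcal{B}'\cap\mathcal{A}$ is the relative commutant of $\mathcal{B}$ in $\mathcal{A}$. A conditional expectation from $\mathcal{A}$ onto $\mathcal{B}$ is a linear, unital, completely positive map $E:\mathcal{A}\to\mathcal{B}$ with $E(b)=b$ for all $b\in\mathcal{B}$. *)

theory Defs
  imports "HOL-Analysis.Analysis"
begin

text \<open>Unital complex C*-algebras. The class is built on \<^class>\<open>monoid_mult\<close> rather than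
  \<open>ring_1\<close>, so that the zero algebra is not excluded. Submultiplicativity of the norm comes from
  \<^class>\<open>real_normed_algebra\<close>, completeness from \<^class>\<open>banach\<close>.\<close>

class cstar_algebra = real_normed_algebra + banach + monoid_mult +
  fixes scaleC :: "complex \<Rightarrow> 'a \<Rightarrow> 'a"  (infixr "*\<^sub>C" 75)
    and star :: "'a \<Rightarrow> 'a"
  assumes scaleC_add_right: "c *\<^sub>C (x + y) = c *\<^sub>C x + c *\<^sub>C y"
    and scaleC_add_left: "(c + d) *\<^sub>C x = c *\<^sub>C x + d *\<^sub>C x"
    and scaleC_scaleC: "c *\<^sub>C d *\<^sub>C x = (c * d) *\<^sub>C x"
    and scaleC_one: "1 *\<^sub>C x = x"
    and scaleR_scaleC: "r *\<^sub>R x = complex_of_real r *\<^sub>C x"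
    and mult_scaleC_left: "(c *\<^sub>C x) * y = c *\<^sub>C (x * y)"
    and mult_scaleC_right: "x * (c *\<^sub>C y) = c *\<^sub>C (x * y)"
    and norm_scaleC: "norm (c *\<^sub>C x) = cmod c * norm x"
    and star_star: "star (star x) = x"
    and star_add: "star (x + y) = star x + star y"
    and star_scaleC: "star (c *\<^sub>C x) = cnj c *\<^sub>C star x"
    and star_mult: "star (x * y) = star y * star x"
    and cstar_identity: "norm (star x * x) = (norm x)\<^sup>2"

global_interpretation complex_vector: vector_space "scaleC :: complex \<Rightarrow> 'a \<Rightarrow> 'a::cstar_algebra"
  by unfold_locales (simp_all add: scaleC_add_right scaleC_add_left scaleC_scaleC scaleC_one)

definition finite_dimensional_algebra :: "'a::cstar_algebra itself \<Rightarrow> bool" where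
  "finite_dimensional_algebra _ \<longleftrightarrow>
     (\<exists>S :: 'a set. finite S \<and> complex_vector.span S = UNIV)"

definition unital_cstar_subalgebra :: "'a::cstar_algebra set \<Rightarrow> bool" where
  "unital_cstar_subalgebra B \<longleftrightarrow>
     complex_vector.subspace B \<and> closed B \<and> 1 \<in> B \<and>
     (\<forall>x\<in>B. \<forall>y\<in>B. x * y \<in> B) \<and> (\<forall>x\<in>B. star x \<in> B)"

definition relative_commutant :: "'a::cstar_algebra set \<Rightarrow> 'a set" where
  "relative_commutant B = {a. \<forall>b\<in>B. a * b = b * a}"

text \<open>An n-by-n matrix over the algebra is a function of two indices below \<open>n\<close>; values at other
  indices are irrelevant. Positive elements of the matrix algebra \<open>M\<^sub>n(S)\<close> over a C*-subalgebra \<open>S\<close>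
  are those of the form \<open>Y\<^sup>* Y\<close> with \<open>Y\<close> in \<open>M\<^sub>n(S)\<close>, where \<open>(Y\<^sup>*)\<^sub>i\<^sub>k = (Y\<^sub>k\<^sub>i)\<^sup>*\<close>.\<close>

definition positive_matrix ::
    "'a::cstar_algebra set \<Rightarrow> nat \<Rightarrow> (nat \<Rightarrow> nat \<Rightarrow> 'a) \<Rightarrow> bool" where
  "positive_matrix S n X \<longleftrightarrow>
     (\<exists>Y. (\<forall>i<n. \<forall>j<n. Y i j \<in> S) \<and>
          (\<forall>i<n. \<forall>j<n. X i j = (\<Sum>k<n. star (Y k i) * Y k j)))"

definition completely_positive ::
    "'a::cstar_algebra set \<Rightarrow> 'a set \<Rightarrow> ('a \<Rightarrow> 'a) \<Rightarrow> bool" where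
  "completely_positive A B E \<longleftrightarrow>
     (\<forall>n X. positive_matrix A n X \<longrightarrow> positive_matrix B n (\<lambda>i j. E (X i j)))"

definition conditional_expectation ::
    "'a::cstar_algebra set \<Rightarrow> ('a \<Rightarrow> 'a) \<Rightarrow> bool" where
  "conditional_expectation B E \<longleftrightarrow>
     Vector_Spaces.linear scaleC scaleC E \<and> range E \<subseteq> B \<and> E 1 = 1 \<and>
     completely_positive UNIV B E \<and> (\<forall>b\<in>B. E b = b)"

end

theory Submission
  imports Defs "HOL-Computational_Algebra.Fundamental_Theorem_Algebra"
begin

text \<open>The trace \<open>\<tau>\<close> of left multiplication on the algebra \<open>A\<close> is a faithful positive trace: for
  \<open>x = a + i b\<close> with \<open>a, b\<close> self-adjoint, \<open>\<tau> (x\<^sup>* x) = \<tau> (a\<^sup>2) + \<tau> (b\<^sup>2)\<close>, and the spectral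
  decomposition makes both summands nonnegative. The \<open>\<tau>\<close>-orthogonal projection \<open>E\<^sub>0\<close> onto \<open>B\<close> is
  a conditional expectation; complete positivity follows from a Cholesky factorization over \<open>B\<close>.

  Every conditional expectation \<open>E\<close> is a \<open>B\<close>-bimodule map, so writing \<open>\<tau> (E x) = \<tau> (h x)\<close>
  the density \<open>h\<close> commutes with \<open>B\<close>. If \<open>B' \<inter> A \<subseteq> B\<close>, then \<open>h \<in> B\<close> and \<open>\<tau> (h b) = \<tau> b\<close> on
  \<open>B\<close>, whence \<open>h = 1\<close> and \<open>E = E\<^sub>0\<close>. Conversely, for a self-adjoint \<open>a \<in> B' \<inter> A\<close> put
  \<open>c = a - E\<^sub>0 a\<close>; for small \<open>\<epsilon> > 0\<close> the map \<open>x \<mapsto> E\<^sub>0 ((1 + \<epsilon> c) x)\<close> is a conditional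
  expectation, and it differs from \<open>E\<^sub>0\<close> unless \<open>c = 0\<close>.\<close>

section \<open>Spectral decomposition\<close>

lemma star_zero [simp]: "star (0::'a::cstar_algebra) = 0"
  using star_add[of "0::'a" 0] by simp

lemma star_minus [simp]: "star (- x) = - star (x::'a::cstar_algebra)"
  using star_add[of x "- x"] by (simp add: eq_neg_iff_add_eq_0 add.commute)

lemma star_diff: "star (x - y) = star x - star (y::'a::cstar_algebra)"
  using star_add[of x "- y"] by simp

lemma star_one [simp]: "star (1::'a::cstar_algebra) = 1"
  using star_mult[of "star (1::'a)" 1] by (simp add: star_star)

lemma star_scaleR: "star (r *\<^sub>R x) = r *\<^sub>R star (x::'a::cstar_algebra)"
  by (simp add: scaleR_scaleC star_scaleC)

lemma star_sum: "star (sum f S) = (\<Sum>i\<in>S. star (f i :: 'a::cstar_algebra))"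
  by (induction S rule: infinite_finite_induct) (simp_all add: star_add)

lemma star_mult_self_eq_0: "star x * x = 0 \<longleftrightarrow> x = (0::'a::cstar_algebra)"
  using cstar_identity[of x] by auto

lemma subalgebra_closed:
  fixes B :: "'a::cstar_algebra set"
  assumes "unital_cstar_subalgebra B"
  shows "0 \<in> B" "1 \<in> B"
    "x \<in> B \<Longrightarrow> y \<in> B \<Longrightarrow> x + y \<in> B"
    "x \<in> B \<Longrightarrow> y \<in> B \<Longrightarrow> x - y \<in> B"
    "x \<in> B \<Longrightarrow> y \<in> B \<Longrightarrow> x * y \<in> B"
    "x \<in> B \<Longrightarrow> - x \<in> B"
    "x \<in> B \<Longrightarrow> c *\<^sub>C x \<in> B"
    "x \<in> B \<Longrightarrow> r *\<^sub>R x \<in> B"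
    "x \<in> B \<Longrightarrow> star x \<in> B"
    "(\<And>i. i \<in> I \<Longrightarrow> f i \<in> B) \<Longrightarrow> sum f I \<in> B"
  using assms unfolding unital_cstar_subalgebra_def
  by (auto simp: scaleR_scaleC intro: complex_vector.subspace_0 complex_vector.subspace_add
      complex_vector.subspace_diff complex_vector.subspace_neg complex_vector.subspace_scale
      complex_vector.subspace_sum)

lemma unital_cstar_subalgebra_UNIV: "unital_cstar_subalgebra (UNIV :: 'a::cstar_algebra set)"
  by (simp add: unital_cstar_subalgebra_def)

section \<open>Polynomials evaluated at an algebra element by Horner's scheme\<close>

definition poly_eval :: "'a::cstar_algebra \<Rightarrow> complex poly \<Rightarrow> 'a" where
  "poly_eval a p = fold_coeffs (\<lambda>c y. c *\<^sub>C 1 + a * y) p 0"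

lemma poly_eval_0 [simp]: "poly_eval a 0 = 0"
  by (simp add: poly_eval_def)

lemma poly_eval_pCons [simp]: "poly_eval a (pCons c p) = c *\<^sub>C 1 + a * poly_eval a p"
  \<comment> \<open>\<open>pCons 0 0\<close> is the zero polynomial, with no coefficient to fold
    over, so it is split off.\<close>
  by (cases "p = 0 \<and> c = 0") (auto simp: poly_eval_def)

lemma poly_eval_add: "poly_eval a (p + q) = poly_eval a p + poly_eval a q"
  by (induction p q rule: poly_induct2) (simp_all add: algebra_simps scaleC_add_left)

lemma poly_eval_smult: "poly_eval a (smult c p) = c *\<^sub>C poly_eval a p"
  by (induction p) (simp_all add: scaleC_add_right mult_scaleC_right scaleC_scaleC)

lemma poly_eval_sum: "poly_eval a (sum f I) = (\<Sum>i\<in>I. poly_eval a (f i))"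
  by (induction I rule: infinite_finite_induct) (simp_all add: poly_eval_add)

lemma poly_eval_monom: "poly_eval a (monom c n) = c *\<^sub>C a ^ n"
  by (induction n) (simp_all add: monom_0 monom_Suc mult_scaleC_right)

lemma poly_eval_linear_factor:
  "poly_eval a ([:- c, 1:] * p) = a * poly_eval a p - c *\<^sub>C poly_eval a p"
proof -
  have "[:- c, 1:] * p = smult (- c) p + pCons 0 p" by simp
  then show ?thesis by (simp only: poly_eval_add poly_eval_smult) simp
qed

lemma poly_eval_commute: "a * poly_eval a p = poly_eval a p * a"
proof (induction p)
  case (pCons c p)
  then show ?case
    by (simp add: distrib_left distrib_right mult_scaleC_left mult_scaleC_right flip: mult.assoc)
qed simp

text \<open>In finite dimension the powers of \<open>a\<close> are linearly dependent. A repeated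
  power is treated apart, because dependence of a set cannot see repetitions.\<close>

lemma annihilating_polynomial_exists:
  fixes a :: "'a::cstar_algebra"
  assumes "finite_dimensional_algebra TYPE('a)"
  obtains p where "p \<noteq> 0" "poly_eval a p = 0"
proof (cases "inj (\<lambda>i. a ^ i)")
  case False
  then obtain i j where ij: "i \<noteq> j" "a ^ i = a ^ j" by (auto simp: inj_def)
  have "coeff (monom (1::complex) i + monom (- 1) j) i \<noteq> 0" using ij by simp
  then have "monom (1::complex) i + monom (- 1) j \<noteq> 0" by fastforce
  moreover have "poly_eval a (monom 1 i + monom (- 1) j) = 0"
    using ij by (simp add: poly_eval_add poly_eval_monom complex_vector.scale_minus_left)
  ultimately show ?thesis using that by blast
next
  case True
  obtain S :: "'a set" where S: "finite S" "complex_vector.span S = UNIV"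
    using assms unfolding finite_dimensional_algebra_def by blast
  have "infinite (range (\<lambda>i. a ^ i))"
    using True by (simp add: finite_image_iff)
  then have "complex_vector.dependent (range (\<lambda>i. a ^ i))"
    using complex_vector.independent_span_bound[OF S(1)] S(2) by auto
  then obtain T u where T: "finite T" "T \<subseteq> range (\<lambda>i. a ^ i)" "\<exists>v\<in>T. u v \<noteq> 0"
      "(\<Sum>v\<in>T. u v *\<^sub>C v) = 0"
    unfolding complex_vector.dependent_explicit by blast
  define I where "I = (\<lambda>i. a ^ i) -` T"
  have TI: "T = (\<lambda>i. a ^ i) ` I" using T(2) by (auto simp: I_def)
  have fI: "finite I" unfolding I_def by (rule finite_vimageI[OF T(1) True])
  define p where "p = (\<Sum>i\<in>I. monom (u (a ^ i)) i)"
  obtain i where i: "i \<in> I" "u (a ^ i) \<noteq> 0" using T(3) TI by auto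
  have "coeff p i = u (a ^ i)"
    using fI i by (simp add: p_def coeff_sum sum.delta)
  then have "p \<noteq> 0" using i by auto
  moreover have "poly_eval a p = (\<Sum>i\<in>I. u (a ^ i) *\<^sub>C a ^ i)"
    by (simp add: p_def poly_eval_sum poly_eval_monom)
  then have "poly_eval a p = 0"
    using T(4) unfolding TI by (simp add: sum.reindex[OF inj_on_subset[OF True]])
  ultimately show ?thesis using that by blast
qed

section \<open>Eigenvectors of left multiplication by a self-adjoint element\<close>

lemma selfadjoint_nonreal_eigenvector_zero:
  fixes a :: "'a::cstar_algebra"
  assumes "star a = a" "a * w = c *\<^sub>C w" "cnj c \<noteq> c"
  shows "w = 0"
proof -
  \<comment> \<open>The left side is self-adjoint, so the right side equals its own adjoint, which
    carries \<open>cnj c\<close> instead of \<open>c\<close>.\<close>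
  have "star w * (a * w) = c *\<^sub>C (star w * w)"
    by (simp add: assms mult_scaleC_right)
  moreover have "star (star w * (a * w)) = star w * (a * w)"
    by (simp add: star_mult star_star assms(1) mult.assoc)
  ultimately have "cnj c *\<^sub>C (star w * w) = c *\<^sub>C (star w * w)"
    by (metis star_scaleC star_mult star_star)
  then show ?thesis
    using assms(3) by (auto simp: complex_vector.scale_cancel_right star_mult_self_eq_0)
qed

text \<open>There are no Jordan blocks: for \<open>z = a * w - r *\<^sub>R w\<close>, moving the
  self-adjoint \<open>a - r\<close> to the other side gives
  \<open>star z * z = star w * (a * z - r *\<^sub>R z) = 0\<close>.\<close>

lemma selfadjoint_generalized_eigenvector:
  fixes a :: "'a::cstar_algebra"
  assumes "star a = a" "a * (a * w - r *\<^sub>R w) = r *\<^sub>R (a * w - r *\<^sub>R w)"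
  shows "a * w = r *\<^sub>R w"
proof -
  define z where "z = a * w - r *\<^sub>R w"
  have "star z * z = star w * (a * z - r *\<^sub>R z)"
    by (simp add: z_def star_diff star_mult star_scaleR assms(1) algebra_simps)
  also have "\<dots> = 0" using assms(2) by (simp add: z_def)
  finally show ?thesis by (simp add: star_mult_self_eq_0 z_def)
qed

text \<open>Elements of \<open>B\<close> serve as vectors for left multiplication by
  \<open>a\<close>. Induction on the degree splits off a root \<open>c\<close> of \<open>p\<close>:
  the cofactor kills \<open>z = (a - c) y\<close>, and the eigencomponents of \<open>z\<close> are
  lifted back to \<open>y\<close>.\<close>

lemma selfadjoint_eigenvector_decomposition:
  fixes a :: "'a::cstar_algebra"
  assumes B: "unital_cstar_subalgebra B" and a: "star a = a" "a \<in> B"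
    and "y \<in> B" "p \<noteq> 0" "poly_eval a p * y = 0"
  shows "\<exists>\<Lambda> e. finite \<Lambda> \<and> (\<forall>l\<in>\<Lambda>. e l \<in> B \<and> a * e l = l *\<^sub>R e l) \<and> y = sum e \<Lambda>"
  using assms(4-)
proof (induction "degree p" arbitrary: p y)
  case 0
  then obtain c where "p = [:c:]" "c \<noteq> 0" by (metis degree_eq_zeroE pCons_0_0)
  then have "y = 0" using 0 by (simp add: mult_scaleC_left)
  then show ?case by (intro exI[of _ "{}"]) simp
next
  case (Suc n)
  have "\<not> constant (poly p)" using Suc.hyps(2) by (simp add: constant_degree)
  then obtain c where "poly p c = 0" using fundamental_theorem_of_algebra by blast
  then obtain q where q: "p = [:- c, 1:] * q" by (auto simp: poly_eq_0_iff_dvd)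
  then have "q \<noteq> 0" using Suc.prems by auto
  then have dq: "n = degree q"
    using Suc.hyps(2) unfolding q by (subst (asm) degree_mult_eq) auto
  define z where "z = a * y - c *\<^sub>C y"
  have zB: "z \<in> B" using Suc.prems a B by (simp add: z_def subalgebra_closed)
  have qz: "poly_eval a q * z = 0"
    using Suc.prems(3) unfolding q poly_eval_linear_factor poly_eval_commute z_def
    by (simp add: algebra_simps mult_scaleC_left mult_scaleC_right)
  from Suc.hyps(1)[OF dq zB \<open>q \<noteq> 0\<close> qz] obtain \<Lambda> e where e: "finite \<Lambda>" "\<And>l. l \<in> \<Lambda> \<Longrightarrow> e l \<in> B"
      "\<And>l. l \<in> \<Lambda> \<Longrightarrow> a * e l = l *\<^sub>R e l" "z = sum e \<Lambda>"
    by metis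
  \<comment> \<open>On an eigenvector for \<open>l\<close>, the operator \<open>a - c\<close> is the
    scalar \<open>l - c\<close>; dividing by it gives the preimage \<open>f l\<close> of
    \<open>e l\<close> whenever \<open>l\<close> differs from \<open>c\<close>. The rest of
    \<open>y\<close> is \<open>w\<close>.\<close>
  define M where "M = {l\<in>\<Lambda>. complex_of_real l \<noteq> c}"
  define f where "f l = (1 / (complex_of_real l - c)) *\<^sub>C e l" for l
  define w where "w = y - sum f M"
  have fM: "finite M" using e by (simp add: M_def)
  have fB: "f l \<in> B" "a * f l = l *\<^sub>R f l" "a * f l - c *\<^sub>C f l = e l" if "l \<in> M" for l
  proof -
    have l: "l \<in> \<Lambda>" "complex_of_real l - c \<noteq> 0" using that by (auto simp: M_def)
    show "f l \<in> B" using e l B by (simp add: f_def subalgebra_closed)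
    show *: "a * f l = l *\<^sub>R f l"
      using e(3)[OF l(1)] by (simp add: f_def mult_scaleC_right scaleR_scaleC scaleC_scaleC mult.commute)
    have "a * f l - c *\<^sub>C f l = (complex_of_real l - c) *\<^sub>C f l"
      by (simp add: * scaleR_scaleC complex_vector.scale_left_diff_distrib)
    then show "a * f l - c *\<^sub>C f l = e l"
      using l by (simp add: f_def scaleC_scaleC)
  qed
  have wB: "w \<in> B" using Suc.prems fB B by (auto simp: w_def intro!: subalgebra_closed)
  have "a * w - c *\<^sub>C w = z - (\<Sum>l\<in>M. a * f l - c *\<^sub>C f l)"
    by (simp add: w_def z_def algebra_simps sum_distrib_left complex_vector.scale_sum_right
        sum_subtractf complex_vector.scale_right_diff_distrib)
  also have "\<dots> = sum e \<Lambda> - sum e M" using fB e(4) by simp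
  also have "\<dots> = sum e (\<Lambda> - M)"
    by (rule sum_diff[symmetric]) (use e in \<open>auto simp: M_def\<close>)
  finally have w: "a * w - c *\<^sub>C w = sum e (\<Lambda> - M)" .
  show ?case
  proof (cases "cnj c = c")
    case False
    \<comment> \<open>The eigenvalues in \<open>\<Lambda>\<close> are real, so none of them equals
      \<open>c\<close>.\<close>
    then have "\<Lambda> - M = {}" by (auto simp: M_def)
    then have "a * w = c *\<^sub>C w" using w by (metis eq_iff_diff_eq_0 sum.empty)
    then have "w = 0" by (rule selfadjoint_nonreal_eigenvector_zero[OF a(1) _ False])
    then show ?thesis
      using fB fM by (intro exI[of _ M] exI[of _ f]) (auto simp: w_def)
  next
    case True
    then obtain r where r: "c = complex_of_real r"
      by (metis Reals_cnj_iff Reals_cases)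
    then have rM: "r \<notin> M" by (simp add: M_def)
    \<comment> \<open>Only the component for \<open>r\<close> can remain in
      \<open>\<Lambda> - M\<close>, so \<open>w\<close> is a generalized eigenvector for
      \<open>r\<close>, hence a genuine one.\<close>
    have "a * sum e (\<Lambda> - M) = r *\<^sub>R sum e (\<Lambda> - M)"
      unfolding sum_distrib_left scaleR_sum_right
      by (rule sum.cong) (use e(3) in \<open>auto simp: M_def r\<close>)
    then have "a * w = r *\<^sub>R w"
      using selfadjoint_generalized_eigenvector[OF a(1), of w r] w by (simp add: r scaleR_scaleC)
    then show ?thesis
      using fB fM rM wB
      by (intro exI[of _ "insert r M"] exI[of _ "f(r := w)"])
        (auto simp: w_def sum.insert intro!: sum.cong)
  qed
qed

text \<open>The eigencomponents of \<open>1\<close> are the spectral projections: they are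
  orthogonal for distinct real eigenvalues, and multiplying \<open>1 = sum e M\<close> by
  \<open>star (e l)\<close> gives \<open>star (e l) = star (e l) * e l\<close>, which makes
  \<open>e l\<close> a self-adjoint idempotent.\<close>

lemma spectral_decomposition:
  fixes a :: "'a::cstar_algebra"
  assumes fd: "finite_dimensional_algebra TYPE('a)" and B: "unital_cstar_subalgebra B"
    and a: "star a = a" "a \<in> B"
  obtains \<Lambda> :: "real set" and e where "finite \<Lambda>"
    "\<And>l. l \<in> \<Lambda> \<Longrightarrow> e l \<in> B" "\<And>l. l \<in> \<Lambda> \<Longrightarrow> e l \<noteq> 0" "\<And>l. l \<in> \<Lambda> \<Longrightarrow> star (e l) = e l"
    "\<And>l m. l \<in> \<Lambda> \<Longrightarrow> m \<in> \<Lambda> \<Longrightarrow> e l * e m = (if l = m then e l else 0)"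
    "sum e \<Lambda> = 1" "a = (\<Sum>l\<in>\<Lambda>. l *\<^sub>R e l)"
proof -
  obtain p where p: "p \<noteq> 0" "poly_eval a p = 0"
    using annihilating_polynomial_exists[OF fd] by blast
  then obtain M e where M: "finite M" "\<And>l. l \<in> M \<Longrightarrow> e l \<in> B"
      "\<And>l. l \<in> M \<Longrightarrow> a * e l = l *\<^sub>R e l" "1 = sum e M"
    using selfadjoint_eigenvector_decomposition[OF B a, of 1 p] subalgebra_closed(2)[OF B] by auto
  have orth: "star (e l) * e m = 0" if "l \<in> M" "m \<in> M" "l \<noteq> m" for l m
  proof -
    have "star (e l) * (a * e m) = star (a * e l) * e m"
      by (simp add: star_mult a mult.assoc)
    then have "(m - l) *\<^sub>R (star (e l) * e m) = 0"
      using that M(3) by (simp add: star_scaleR algebra_simps)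
    then show ?thesis using that by simp
  qed
  have "star (e l) = star (e l) * e l" if "l \<in> M" for l
  proof -
    have "star (e l) = star (e l) * sum e M" using M by simp
    also have "\<dots> = (\<Sum>m\<in>M. if m = l then star (e l) * e l else 0)"
      unfolding sum_distrib_left using orth that by (intro sum.cong) auto
    finally show ?thesis using M(1) that by (simp add: sum.delta')
  qed
  then have sa: "star (e l) = e l" if "l \<in> M" for l
    using that by (metis star_mult star_star)
  have mult: "e l * e m = (if l = m then e l else 0)" if "l \<in> M" "m \<in> M" for l m
    using that orth sa \<open>\<And>l. l \<in> M \<Longrightarrow> star (e l) = star (e l) * e l\<close> by auto
  define \<Lambda> where "\<Lambda> = {l\<in>M. e l \<noteq> 0}"
  have one: "sum e \<Lambda> = 1"
    unfolding M(4) by (rule sum.mono_neutral_left) (use M in \<open>auto simp: \<Lambda>_def\<close>)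
  have "a = a * sum e \<Lambda>" by (simp add: one)
  also have "\<dots> = (\<Sum>l\<in>\<Lambda>. l *\<^sub>R e l)"
    unfolding sum_distrib_left by (rule sum.cong) (use M in \<open>auto simp: \<Lambda>_def\<close>)
  finally show ?thesis
    using M(1,2) sa mult one by (intro that[of \<Lambda> e]) (auto simp: \<Lambda>_def)
qed

section \<open>The faithful trace\<close>

definition complex_basis :: "'a::cstar_algebra set \<Rightarrow> bool" where
  "complex_basis P \<longleftrightarrow> finite P \<and> complex_vector.independent P \<and> complex_vector.span P = UNIV"

lemma finite_dim_independent_finite:
  fixes S :: "'a::cstar_algebra set"
  assumes "finite_dimensional_algebra TYPE('a)" "complex_vector.independent S"
  shows "finite S"
  using assms complex_vector.independent_span_bound unfolding finite_dimensional_algebra_def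
  by (metis subset_UNIV)

lemma complex_basis_extend:
  fixes S :: "'a::cstar_algebra set"
  assumes "finite_dimensional_algebra TYPE('a)" "complex_vector.independent S"
  obtains P where "S \<subseteq> P" "complex_basis P"
proof -
  obtain P where P: "S \<subseteq> P" "complex_vector.independent P" "UNIV \<subseteq> complex_vector.span P"
    by (rule complex_vector.maximal_independent_subset_extend[OF subset_UNIV assms(2)])
  then have "complex_basis P"
    using finite_dim_independent_finite[OF assms(1)] by (auto simp: complex_basis_def)
  then show ?thesis by (rule that[OF P(1)])
qed

lemma representation_linear:
  assumes "complex_basis P"
  shows "complex_vector.representation P (x + y) p =
      complex_vector.representation P x p + complex_vector.representation P y p"
    and "complex_vector.representation P (c *\<^sub>C x) p = c * complex_vector.representation P x p"
    and "complex_vector.representation P (sum f I) p =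
      (\<Sum>i\<in>I. complex_vector.representation P (f i) p)"
  using assms unfolding complex_basis_def
  by (simp_all add: complex_vector.representation_add complex_vector.representation_scale
      complex_vector.representation_sum)

lemma representation_image:
  fixes f :: "'a::cstar_algebra \<Rightarrow> 'a"
  assumes P: "complex_basis P" and Q: "complex_basis Q" and f: "Vector_Spaces.linear scaleC scaleC f"
  shows "complex_vector.representation Q (f y) q =
    (\<Sum>p\<in>P. complex_vector.representation P y p * complex_vector.representation Q (f p) q)"
proof -
  interpret f: Vector_Spaces.linear scaleC scaleC f by (rule f)
  have "y = (\<Sum>p\<in>P. complex_vector.representation P y p *\<^sub>C p)"
    using P unfolding complex_basis_def
    by (subst complex_vector.sum_representation_eq) auto
  then have "f y = (\<Sum>p\<in>P. complex_vector.representation P y p *\<^sub>C f p)"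
    by (metis (no_types, lifting) f.scale f.sum sum.cong)
  then show ?thesis by (simp add: representation_linear[OF Q])
qed

text \<open>Both sides are one double sum of matrix entries of \<open>f\<close> and
  \<open>g\<close>, taken in two orders. The case \<open>P = Q\<close> gives traciality, the case of
  \<open>g\<close> the identity gives independence of the basis.\<close>

lemma trace_cyclic_bases:
  fixes f g :: "'a::cstar_algebra \<Rightarrow> 'a"
  assumes P: "complex_basis P" and Q: "complex_basis Q"
    and f: "Vector_Spaces.linear scaleC scaleC f" and g: "Vector_Spaces.linear scaleC scaleC g"
  shows "(\<Sum>p\<in>P. complex_vector.representation P (f (g p)) p) =
    (\<Sum>q\<in>Q. complex_vector.representation Q (g (f q)) q)"
proof -
  have "(\<Sum>p\<in>P. complex_vector.representation P (f (g p)) p) =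
      (\<Sum>p\<in>P. \<Sum>q\<in>Q. complex_vector.representation Q (g p) q * complex_vector.representation P (f q) p)"
    by (intro sum.cong refl representation_image[OF Q P f])
  also have "\<dots> = (\<Sum>q\<in>Q. \<Sum>p\<in>P. complex_vector.representation P (f q) p * complex_vector.representation Q (g p) q)"
    by (subst sum.swap) (simp add: mult.commute)
  also have "\<dots> = (\<Sum>q\<in>Q. complex_vector.representation Q (g (f q)) q)"
    by (intro sum.cong refl representation_image[OF P Q g, symmetric])
  finally show ?thesis .
qed

definition left_trace :: "'a::cstar_algebra set \<Rightarrow> 'a \<Rightarrow> complex" where
  "left_trace P x = (\<Sum>p\<in>P. complex_vector.representation P (x * p) p)"

lemma linear_left_mult: "Vector_Spaces.linear scaleC scaleC (\<lambda>y. x * y :: 'a::cstar_algebra)"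
  unfolding Vector_Spaces.linear_iff
  using complex_vector.vector_space_axioms by (auto simp: distrib_left mult_scaleC_right)

lemma linear_scaleC_id: "Vector_Spaces.linear scaleC scaleC (\<lambda>y. y :: 'a::cstar_algebra)"
  unfolding Vector_Spaces.linear_iff using complex_vector.vector_space_axioms by auto

lemma left_trace_commute:
  "complex_basis P \<Longrightarrow> left_trace P (x * y) = left_trace P (y * x)"
  using trace_cyclic_bases[OF _ _ linear_left_mult[of x] linear_left_mult[of y], of P P]
  by (simp add: left_trace_def mult.assoc)

lemma left_trace_basis_independent:
  "complex_basis P \<Longrightarrow> complex_basis Q \<Longrightarrow> left_trace P x = left_trace Q x"
  using trace_cyclic_bases[OF _ _ linear_left_mult[of x] linear_scaleC_id, of P Q]
  by (simp add: left_trace_def)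

text \<open>The trace of an idempotent is its rank. Extend a basis \<open>S\<close> of the range to
  a basis \<open>Q\<close>: \<open>e\<close> fixes the members of \<open>S\<close>, while
  \<open>e * q\<close> for any other \<open>q\<close> expands in \<open>S\<close> alone, so the
  diagonal entries are 1 and 0.\<close>

lemma left_trace_idempotent:
  fixes e :: "'a::cstar_algebra"
  assumes fd: "finite_dimensional_algebra TYPE('a)" and P: "complex_basis P"
    and e: "e * e = e" "e \<noteq> 0"
  obtains n :: nat where "n > 0" "left_trace P e = of_nat n"
proof -
  let ?V = "range (\<lambda>x. e * x)"
  obtain S where S: "S \<subseteq> ?V" "complex_vector.independent S" "?V \<subseteq> complex_vector.span S"
    using complex_vector.maximal_independent_subset by blast
  obtain Q where Q: "S \<subseteq> Q" "complex_basis Q"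
    using complex_basis_extend[OF fd S(2)] by blast
  have fS: "finite S" using finite_dim_independent_finite[OF fd S(2)] .
  have "complex_vector.representation Q (e * q) q = (if q \<in> S then 1 else 0)" if q: "q \<in> Q" for q
  proof (cases "q \<in> S")
    case True
    then obtain x where "q = e * x" using S by auto
    then have "e * q = q" using e by (simp add: mult.assoc[symmetric])
    then show ?thesis
      using True Q q by (simp add: complex_vector.representation_basis complex_basis_def)
  next
    case False
    have "complex_vector.representation Q (e * q) = complex_vector.representation S (e * q)"
      using Q S(3) by (intro complex_vector.representation_extend) (auto simp: complex_basis_def)
    then show ?thesis using False complex_vector.representation_ne_zero by metis
  qed
  then have "left_trace Q e = (\<Sum>q\<in>Q. if q \<in> S then 1 else 0)"
    by (simp add: left_trace_def)
  also have "\<dots> = of_nat (card S)"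
    using Q by (simp add: sum.If_cases complex_basis_def Int_absorb1)
  finally have "left_trace P e = of_nat (card S)"
    using left_trace_basis_independent[OF P Q(2)] by simp
  moreover have "S \<noteq> {}"
  proof
    assume "S = {}"
    then have "e * 1 = 0" using S(3) by (metis complex_vector.span_empty rangeI singletonD subsetD)
    then show False using e by simp
  qed
  ultimately show ?thesis using that fS by (meson card_gt_0_iff)
qed

text \<open>These axioms make \<open>\<tau> (star x * y)\<close> an inner product. Its diagonal
  values are real by \<open>star\<close>, so positivity and faithfulness can be stated for the real
  part.\<close>

locale faithful_trace =
  fixes \<tau> :: "'a::cstar_algebra \<Rightarrow> complex"
  assumes add: "\<tau> (x + y) = \<tau> x + \<tau> y"
    and scaleC: "\<tau> (c *\<^sub>C x) = c * \<tau> x"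
    and commute: "\<tau> (x * y) = \<tau> (y * x)"
    and star: "\<tau> (star x) = cnj (\<tau> x)"
    and nonneg: "0 \<le> Re (\<tau> (star x * x))"
    and faithful: "Re (\<tau> (star x * x)) = 0 \<Longrightarrow> x = 0"

text \<open>The formulas for both parts are exported so that membership in a commutant can be read
  off from them.\<close>

lemma cartesian_decomposition:
  fixes x :: "'a::cstar_algebra"
  obtains a b where "star a = a" "star b = b" "x = a + \<i> *\<^sub>C b"
    "a = (1/2) *\<^sub>C (x + star x)" "b = (- \<i> / 2) *\<^sub>C (x - star x)"
proof (rule that[OF _ _ _ refl refl])
  show "x = (1/2) *\<^sub>C (x + star x) + \<i> *\<^sub>C ((- \<i> / 2) *\<^sub>C (x - star x))"
    using scaleC_add_left[of "1/2" "1/2" x]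
    by (simp add: scaleC_scaleC scaleC_one flip: scaleC_add_right)
  show "star ((- \<i> / 2) *\<^sub>C (x - star x)) = (- \<i> / 2) *\<^sub>C (x - star x)"
    by (simp add: star_scaleC star_diff star_star complex_vector.scale_right_diff_distrib)
  show "star ((1/2) *\<^sub>C (x + star x)) = (1/2) *\<^sub>C (x + star x)"
    by (simp add: star_scaleC star_add star_star add.commute)
qed

lemma faithful_trace_exists:
  assumes fd: "finite_dimensional_algebra TYPE('a::cstar_algebra)"
  obtains \<tau> :: "'a::cstar_algebra \<Rightarrow> complex" where "faithful_trace \<tau>"
proof -
  obtain P :: "'a set" where P: "complex_basis P"
    using complex_basis_extend[OF fd complex_vector.independent_empty] by blast
  define \<tau> where "\<tau> = left_trace P"
  have add: "\<tau> (x + y) = \<tau> x + \<tau> y" for x y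
    by (simp add: \<tau>_def left_trace_def distrib_right representation_linear[OF P] sum.distrib)
  have scale: "\<tau> (c *\<^sub>C x) = c * \<tau> x" for c x
    by (simp add: \<tau>_def left_trace_def mult_scaleC_left representation_linear[OF P] sum_distrib_left)
  have zero: "\<tau> 0 = 0" using add[of 0 0] by simp
  have tsum: "\<tau> (sum f I) = (\<Sum>i\<in>I. \<tau> (f i))" for f :: "real \<Rightarrow> 'a" and I
    by (induction I rule: infinite_finite_induct) (simp_all add: add zero)
  have comm: "\<tau> (x * y) = \<tau> (y * x)" for x y
    using left_trace_commute[OF P] by (simp add: \<tau>_def)
  \<comment> \<open>With \<open>n l\<close> the positive trace of the projection \<open>e l\<close>,
    the value \<open>\<tau> (a * a)\<close> is the sum of all \<open>l * l * n l\<close>, which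
    vanishes only if every eigenvalue does.\<close>
  have sa: "\<tau> a \<in> \<real> \<and> 0 \<le> Re (\<tau> (a * a)) \<and> (Re (\<tau> (a * a)) = 0 \<longrightarrow> a = 0)"
    if a: "star a = a" for a
  proof -
    obtain \<Lambda> :: "real set" and e where e: "finite \<Lambda>" "\<And>l. l \<in> \<Lambda> \<Longrightarrow> e l \<noteq> 0"
        "\<And>l m. l \<in> \<Lambda> \<Longrightarrow> m \<in> \<Lambda> \<Longrightarrow> e l * e m = (if l = m then e l else 0)"
        "a = (\<Sum>l\<in>\<Lambda>. l *\<^sub>R e l)"
      using spectral_decomposition[OF fd unital_cstar_subalgebra_UNIV a UNIV_I] by metis
    have "\<exists>n. n > 0 \<and> \<tau> (e l) = of_nat n" if "l \<in> \<Lambda>" for l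
      using left_trace_idempotent[OF fd P, of "e l"] e(2,3)[OF that] that unfolding \<tau>_def
      by (metis (full_types) e(3))
    then obtain n where n: "\<And>l. l \<in> \<Lambda> \<Longrightarrow> n l > (0::nat) \<and> \<tau> (e l) = of_nat (n l)" by metis
    have "\<tau> a = (\<Sum>l\<in>\<Lambda>. complex_of_real (l * real (n l)))"
      unfolding e(4) tsum by (rule sum.cong) (auto simp: scaleR_scaleC scale n)
    then have real: "\<tau> a \<in> \<real>" by (auto intro: sum_in_Reals)
    have "a * a = (\<Sum>l\<in>\<Lambda>. \<Sum>m\<in>\<Lambda>. if l = m then (l * l) *\<^sub>R e l else 0)"
      unfolding e(4) sum_product by (intro sum.cong) (auto simp: e(3))
    also have "\<dots> = (\<Sum>l\<in>\<Lambda>. (l * l) *\<^sub>R e l)" using e(1) by simp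
    finally have "\<tau> (a * a) = (\<Sum>l\<in>\<Lambda>. complex_of_real (l * l * real (n l)))"
      unfolding tsum by (auto simp: scaleR_scaleC scale n tsum intro!: sum.cong)
    then have sq: "Re (\<tau> (a * a)) = (\<Sum>l\<in>\<Lambda>. l * l * real (n l))" by simp
    have "a = 0" if "Re (\<tau> (a * a)) = 0"
    proof -
      have "\<forall>l\<in>\<Lambda>. l * l * real (n l) = 0"
        using that unfolding sq by (subst (asm) sum_nonneg_eq_0_iff[OF e(1)]) auto
      then have "\<forall>l\<in>\<Lambda>. l = 0" using n by fastforce
      then show ?thesis unfolding e(4) by (intro sum.neutral) auto
    qed
    then show ?thesis using real unfolding sq by (auto intro!: sum_nonneg)
  qed
  have "faithful_trace \<tau>"
  proof
    fix x :: 'a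
    obtain a b where ab: "star a = a" "star b = b" "x = a + \<i> *\<^sub>C b"
      using cartesian_decomposition by metis
    have sx: "star x = a + (- \<i>) *\<^sub>C b"
      by (simp add: ab star_add star_scaleC)
    have "\<tau> x = \<tau> a + \<i> * \<tau> b" by (simp only: ab(3) add scale)
    moreover have "\<tau> (star x) = \<tau> a + (- \<i>) * \<tau> b" by (simp only: sx add scale)
    moreover have "cnj (\<tau> a) = \<tau> a" "cnj (\<tau> b) = \<tau> b"
      using sa[OF ab(1)] sa[OF ab(2)] by (simp_all add: Reals_cnj_iff)
    ultimately show "\<tau> (star x) = cnj (\<tau> x)" by simp
    have "star x * x = (a + (- \<i>) *\<^sub>C b) * (a + \<i> *\<^sub>C b)"
      by (simp only: sx ab(3)[symmetric])
    also have "\<dots> = a * a + \<i> *\<^sub>C (a * b) + ((- \<i>) *\<^sub>C (b * a) + b * b)"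
      by (simp only: distrib_left distrib_right mult_scaleC_left mult_scaleC_right scaleC_scaleC
          scaleC_add_right)
        (simp add: scaleC_one)
    \<comment> \<open>The cross terms cancel because \<open>\<tau>\<close> does not distinguish
      \<open>a * b\<close> from \<open>b * a\<close>.\<close>
    finally have "\<tau> (star x * x) = \<tau> (a * a) + \<tau> (b * b)"
      by (simp only: add scale comm[of b a]) simp
    then have re: "Re (\<tau> (star x * x)) = Re (\<tau> (a * a)) + Re (\<tau> (b * b))" by simp
    then show "0 \<le> Re (\<tau> (star x * x))" using sa[OF ab(1)] sa[OF ab(2)] by simp
    show "x = 0" if "Re (\<tau> (star x * x)) = 0"
    proof -
      have "Re (\<tau> (a * a)) = 0" "Re (\<tau> (b * b)) = 0"
        using that sa[OF ab(1)] sa[OF ab(2)] unfolding re by linarith+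
      then show ?thesis using sa[OF ab(1)] sa[OF ab(2)] ab(3) by simp
    qed
  qed (fact add scale comm)+
  then show ?thesis using that by blast
qed

section \<open>Orthogonality with respect to the trace form\<close>

context faithful_trace
begin

lemma zero [simp]: "\<tau> 0 = 0"
  using add[of 0 0] by simp

lemma minus: "\<tau> (- x) = - \<tau> x"
  using add[of x "- x"] by (simp add: eq_neg_iff_add_eq_0 add.commute)

lemma diff: "\<tau> (x - y) = \<tau> x - \<tau> y"
  using add[of x "- y"] by (simp add: minus)

lemma scaleR: "\<tau> (r *\<^sub>R x) = complex_of_real r * \<tau> x"
  by (simp add: scaleR_scaleC scaleC)

lemma sum: "\<tau> (sum f I) = (\<Sum>i\<in>I. \<tau> (f i))"
  by (induction I rule: infinite_finite_induct) (simp_all add: add)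

text \<open>The test element is \<open>star h\<close>.\<close>

lemma nondegenerate: "(\<And>x. \<tau> (h * x) = 0) \<Longrightarrow> h = 0"
  using faithful[of h] commute[of h "star h"] by (metis zero_complex.sel(1))

lemma star_swap: "\<tau> (star x * y) = cnj (\<tau> (star y * x))"
  using star[of "star y * x"] by (simp add: star_mult star_star)

text \<open>Under \<open>\<tau>\<close> the sum becomes nonnegative reals adding up to zero;
  faithfulness then kills each term.\<close>

lemma sum_star_mult_self_eq_0:
  fixes w :: "'b \<Rightarrow> 'a"
  assumes "finite K" "(\<Sum>k\<in>K. star (w k) * w k) = 0" "k \<in> K"
  shows "w k = 0"
proof -
  have "(\<Sum>k\<in>K. Re (\<tau> (star (w k) * w k))) = Re (\<tau> (\<Sum>k\<in>K. star (w k) * w k))"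
    by (simp add: sum)
  also have "\<dots> = 0" by (simp add: assms)
  finally show ?thesis
    using sum_nonneg_eq_0_iff[OF assms(1), of "\<lambda>k. Re (\<tau> (star (w k) * w k))"] nonneg
      assms(3) faithful by auto
qed

text \<open>Gram-Schmidt, one generator at a time: \<open>d\<close> is the part of \<open>s\<close>
  orthogonal to the old span, and the projection of \<open>x\<close> gains its component along
  \<open>d\<close>.\<close>

lemma orthogonal_projection_exists_span:
  assumes "finite S"
  shows "\<exists>y\<in>complex_vector.span S. \<forall>b\<in>complex_vector.span S. \<tau> (star b * (x - y)) = 0"
  using assms
proof (induction S arbitrary: x rule: finite_induct)
  case empty
  then show ?case by simp
next
  case (insert s S)
  let ?S = "complex_vector.span S"
  obtain s0 where s0: "s0 \<in> ?S" "\<And>b. b \<in> ?S \<Longrightarrow> \<tau> (star b * (s - s0)) = 0"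
    using insert.IH[of s] by blast
  obtain y0 where y0: "y0 \<in> ?S" "\<And>b. b \<in> ?S \<Longrightarrow> \<tau> (star b * (x - y0)) = 0"
    using insert.IH[of x] by blast
  define d where "d = s - s0"
  \<comment> \<open>The Fourier coefficient of \<open>x\<close> along \<open>d\<close>. If
    \<open>d = 0\<close>, division by zero makes \<open>c = 0\<close>, and the identity needed below
    still holds.\<close>
  define c where "c = \<tau> (star d * x) / \<tau> (star d * d)"
  define y where "y = y0 + c *\<^sub>C d"
  have sub: "?S \<subseteq> complex_vector.span (insert s S)"
    by (rule complex_vector.span_mono) auto
  have d_in: "d \<in> complex_vector.span (insert s S)"
    unfolding d_def using s0(1) sub complex_vector.span_base[of s "insert s S"]
    by (intro complex_vector.span_diff) auto
  have "\<tau> (star d * y0) = 0"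
    using s0(2)[OF y0(1)] star_swap[of d y0] by (simp add: d_def)
  moreover have "c * \<tau> (star d * d) = \<tau> (star d * x)"
  proof (cases "d = 0")
    case False
    then have "\<tau> (star d * d) \<noteq> 0" using faithful by fastforce
    then show ?thesis by (simp add: c_def)
  qed simp
  ultimately have dy: "\<tau> (star d * (x - y)) = 0"
    by (simp add: y_def diff add scaleC right_diff_distrib distrib_left mult_scaleC_right)
  show ?case
  proof (intro bexI[of _ y] ballI)
    fix b assume "b \<in> complex_vector.span (insert s S)"
    then obtain k where k: "b - k *\<^sub>C s \<in> ?S"
      unfolding complex_vector.span_breakdown_eq by blast
    define b' where "b' = b - k *\<^sub>C s + k *\<^sub>C s0"
    have b': "b' \<in> ?S"
      unfolding b'_def using k s0(1)
      by (intro complex_vector.span_add complex_vector.span_scale) auto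
    have b: "b = k *\<^sub>C d + b'"
      by (simp add: b'_def d_def complex_vector.scale_right_diff_distrib)
    have "\<tau> (star b' * (x - y)) = 0"
      using y0(2)[OF b'] s0(2)[OF b']
      by (simp add: y_def d_def[symmetric] diff add scaleC right_diff_distrib distrib_left
          mult_scaleC_right)
    then show "\<tau> (star b * (x - y)) = 0"
      using dy by (simp add: b star_add star_scaleC distrib_right mult_scaleC_left add scaleC)
  next
    show "y \<in> complex_vector.span (insert s S)"
      unfolding y_def using y0(1) sub d_in
      by (intro complex_vector.span_add complex_vector.span_scale) auto
  qed
qed

lemma orthogonal_projection_exists:
  assumes fd: "finite_dimensional_algebra TYPE('a)" and V: "complex_vector.subspace V"
  shows "\<exists>y\<in>V. \<forall>b\<in>V. \<tau> (star b * (x - y)) = 0"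
proof -
  obtain S where S: "S \<subseteq> V" "complex_vector.independent S" "V \<subseteq> complex_vector.span S"
    by (rule complex_vector.maximal_independent_subset)
  have "complex_vector.span S = V"
    using S complex_vector.span_minimal[OF S(1) V] by auto
  then show ?thesis
    using orthogonal_projection_exists_span[OF finite_dim_independent_finite[OF fd S(2)], of x]
    by simp
qed

text \<open>A nonzero \<open>w\<close> orthogonal to the kernel of \<open>f\<close> represents
  \<open>f\<close> up to a factor, which evaluation at \<open>w\<close> determines.\<close>

lemma riesz_representation:
  assumes fd: "finite_dimensional_algebra TYPE('a)"
    and f: "\<And>x y. f (x + y) = f x + f y" "\<And>c x. f (c *\<^sub>C x) = c * f x"
  obtains h where "\<And>x. f x = \<tau> (h * x)"
proof (cases "\<exists>x. f x \<noteq> 0")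
  case False
  then show ?thesis using that[of 0] by simp
next
  case True
  then obtain x0 where x0: "f x0 \<noteq> 0" by blast
  have f0: "f 0 = 0" using f(1)[of 0 0] by simp
  have fdiff: "f (x - y) = f x - f y" for x y
    using f(1)[of "x - y" y] by simp
  have V: "complex_vector.subspace {x. f x = 0}"
    by (auto simp: complex_vector.subspace_def f f0)
  obtain y where y: "f y = 0" "\<And>b. f b = 0 \<Longrightarrow> \<tau> (star b * (x0 - y)) = 0"
    using orthogonal_projection_exists[OF fd V, of x0] by auto
  define w where "w = x0 - y"
  have fw: "f w \<noteq> 0" using x0 y by (simp add: w_def fdiff)
  then have "w \<noteq> 0" using f0 by auto
  then have ww: "\<tau> (star w * w) \<noteq> 0" using faithful by fastforce
  have perp: "\<tau> (star w * b) = 0" if "f b = 0" for b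
    using y(2)[OF that] star_swap[of w b] by (simp add: w_def)
  have "f x = \<tau> (((f w / \<tau> (star w * w)) *\<^sub>C star w) * x)" for x
  proof -
    have "f (x - (f x / f w) *\<^sub>C w) = 0" using fw by (simp add: fdiff f)
    from perp[OF this] have "\<tau> (star w * x) = f x / f w * \<tau> (star w * w)"
      by (simp add: right_diff_distrib diff mult_scaleC_right scaleC)
    then show ?thesis using fw ww by (simp add: mult_scaleC_left scaleC)
  qed
  then show ?thesis by (rule that)
qed

end

section \<open>Positive matrices over the subalgebra\<close>

locale faithful_trace_inclusion = faithful_trace \<tau> for \<tau> :: "'a::cstar_algebra \<Rightarrow> complex" +
  fixes B :: "'a set"
  assumes fin_dim: "finite_dimensional_algebra TYPE('a)"
    and subalgebra: "unital_cstar_subalgebra B"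
begin

lemmas B_closed [simp, intro] = subalgebra_closed[OF subalgebra]

text \<open>Functional calculus on the spectral projections, which lie in \<open>B\<close>:
  \<open>s\<close> is the square root of \<open>x\<close> and \<open>t\<close> the pseudo-inverse of
  \<open>s\<close>.\<close>

lemma square_root_exists:
  assumes x: "x \<in> B" "star x = x" and pos: "\<And>y. y \<in> B \<Longrightarrow> 0 \<le> Re (\<tau> (star y * x * y))"
  obtains s t where "s \<in> B" "t \<in> B" "star s = s" "star t = t" "s * s = x" "s * t = t * s"
    "t * s * t = t" "x * s * t = x"
proof -
  obtain \<Lambda> :: "real set" and e where fin: "finite \<Lambda>"
    and e: "\<And>l. l \<in> \<Lambda> \<Longrightarrow> e l \<in> B" "\<And>l. l \<in> \<Lambda> \<Longrightarrow> e l \<noteq> 0" "\<And>l. l \<in> \<Lambda> \<Longrightarrow> star (e l) = e l"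
      "\<And>l m. l \<in> \<Lambda> \<Longrightarrow> m \<in> \<Lambda> \<Longrightarrow> e l * e m = (if l = m then e l else 0)"
    and one: "sum e \<Lambda> = 1" and xe: "x = (\<Sum>l\<in>\<Lambda>. l *\<^sub>R e l)"
    by (rule spectral_decomposition[OF fin_dim subalgebra x(2,1)]) blast
  define g where "g f = (\<Sum>l\<in>\<Lambda>. f l *\<^sub>R e l)" for f
  have g_mult: "g f1 * g f2 = g (\<lambda>l. f1 l * f2 l)" for f1 f2
  proof -
    have "g f1 * g f2 = (\<Sum>l\<in>\<Lambda>. \<Sum>m\<in>\<Lambda>. if l = m then (f1 l * f2 l) *\<^sub>R e l else 0)"
      unfolding g_def sum_product by (intro sum.cong) (auto simp: e(4))
    then show ?thesis using fin by (simp add: g_def)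
  qed
  have g_star: "star (g f) = g f" for f
    unfolding g_def star_sum by (rule sum.cong) (auto simp: star_scaleR e(3))
  have g_cong: "g f1 = g f2" if "\<And>l. l \<in> \<Lambda> \<Longrightarrow> f1 l = f2 l" for f1 f2
    unfolding g_def using that by simp
  have g_in: "g f \<in> B" for f
    unfolding g_def using e(1) by auto
  have xg: "x = g (\<lambda>l. l)" by (simp add: g_def xe)
  have nn: "0 \<le> l" if l: "l \<in> \<Lambda>" for l
  proof -
    have "x * e l = (\<Sum>m\<in>\<Lambda>. if m = l then l *\<^sub>R e l else 0)"
      unfolding xe sum_distrib_right by (rule sum.cong) (auto simp: e(4) l)
    then have "x * e l = l *\<^sub>R e l" using fin l by simp
    then have "star (e l) * x * e l = l *\<^sub>R (star (e l) * e l)"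
      by (simp add: mult.assoc)
    \<comment> \<open>Testing the positivity hypothesis at the projection \<open>e l\<close>
      isolates the eigenvalue \<open>l\<close>.\<close>
    then have "0 \<le> l * Re (\<tau> (star (e l) * e l))"
      using pos[OF e(1)[OF l]] by (simp add: scaleR)
    moreover have "0 < Re (\<tau> (star (e l) * e l))"
      using nonneg[of "e l"] faithful[of "e l"] e(2)[OF l] by fastforce
    ultimately show ?thesis by (simp add: zero_le_mult_iff)
  qed
  \<comment> \<open>The convention \<open>inverse 0 = 0\<close> makes the second element a
    pseudo-inverse even when 0 is an eigenvalue.\<close>
  show ?thesis
  proof (rule that[of "g sqrt" "g (\<lambda>l. inverse (sqrt l))"])
    show "g sqrt * g sqrt = x" unfolding xg g_mult by (rule g_cong) (simp add: nn)
    show "g sqrt * g (\<lambda>l. inverse (sqrt l)) = g (\<lambda>l. inverse (sqrt l)) * g sqrt"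
      unfolding g_mult by (rule g_cong) simp
    show "g (\<lambda>l. inverse (sqrt l)) * g sqrt * g (\<lambda>l. inverse (sqrt l)) = g (\<lambda>l. inverse (sqrt l))"
      unfolding g_mult by (rule g_cong) (auto simp: field_simps)
    show "x * g sqrt * g (\<lambda>l. inverse (sqrt l)) = x"
      unfolding xg g_mult by (rule g_cong) (auto simp: field_simps)
  qed (simp_all add: g_in g_star)
qed

section \<open>Cholesky factorization over \<open>B\<close>\<close>

definition quadratic_form :: "nat \<Rightarrow> (nat \<Rightarrow> nat \<Rightarrow> 'a) \<Rightarrow> (nat \<Rightarrow> 'a) \<Rightarrow> real" where
  "quadratic_form n X v = Re (\<tau> (\<Sum>i<n. \<Sum>j<n. star (v i) * X i j * v j))"

text \<open>The two cross terms between \<open>c\<close> and the old coordinates are complex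
  conjugates under \<open>\<tau>\<close>, which produces the factor 2.\<close>

lemma quadratic_form_Suc:
  assumes herm: "\<And>i. i < n \<Longrightarrow> star (X n i) = X i n"
  defines "u \<equiv> \<lambda>v. \<Sum>j<n. X n j * v j"
  shows "quadratic_form (Suc n) X (v(n := c)) =
    quadratic_form n X v + 2 * Re (\<tau> (star c * u v)) + Re (\<tau> (star c * X n n * c))"
proof -
  have "(\<Sum>i<Suc n. \<Sum>j<Suc n. star ((v(n := c)) i) * X i j * (v(n := c)) j) =
      (\<Sum>i<n. \<Sum>j<n. star (v i) * X i j * v j) + (\<Sum>i<n. star (v i) * X i n * c)
      + ((\<Sum>j<n. star c * X n j * v j) + star c * X n n * c)"
    by (simp add: sum.distrib)
  also have "(\<Sum>j<n. star c * X n j * v j) = star c * u v"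
    by (simp add: u_def sum_distrib_left mult.assoc)
  also have "(\<Sum>i<n. star (v i) * X i n * c) = star (u v) * c"
    by (simp add: u_def star_sum star_mult sum_distrib_right herm)
  finally show ?thesis
    using star_swap[of "u v" c] unfolding quadratic_form_def by (simp only: add) simp
qed

text \<open>Induction on \<open>n\<close> with the last index as pivot: factor the Schur complement
  and append one row. Scalar inequalities under \<open>\<tau>\<close> suffice as the positivity
  test. The pivot may be singular, so its row must first be shown to lie in its range.\<close>

lemma positive_matrix_if_quadratic_form_nonneg:
  assumes "\<And>i j. i < n \<Longrightarrow> j < n \<Longrightarrow> X i j \<in> B"
    and "\<And>i j. i < n \<Longrightarrow> j < n \<Longrightarrow> star (X i j) = X j i"
    and "\<And>v. (\<And>i. v i \<in> B) \<Longrightarrow> 0 \<le> quadratic_form n X v"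
  shows "positive_matrix B n X"
  using assms
proof (induction n arbitrary: X)
  case 0
  then show ?case by (simp add: positive_matrix_def)
next
  case (Suc n)
  note XB = Suc.prems(1) and herm = Suc.prems(2) and pos = Suc.prems(3)
  define u where "u v = (\<Sum>j<n. X n j * v j)" for v
  have uB: "u v \<in> B" if "\<And>i. v i \<in> B" for v
    unfolding u_def using that XB by auto
  have form: "0 \<le> quadratic_form n X v + 2 * Re (\<tau> (star c * u v)) + Re (\<tau> (star c * X n n * c))"
    if "\<And>i. v i \<in> B" "c \<in> B" for v c
  proof -
    have "0 \<le> quadratic_form (Suc n) X (v(n := c))" by (rule pos) (simp add: that)
    then show ?thesis using quadratic_form_Suc[of n X v c] herm by (simp add: u_def)
  qed
  have nn: "0 \<le> Re (\<tau> (star y * X n n * y))" if "y \<in> B" for y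
    using form[of "\<lambda>_. 0" y] that by (simp add: u_def quadratic_form_def)
  obtain s t where st: "s \<in> B" "t \<in> B" "star s = s" "star t = t" "s * s = X n n"
      "s * t = t * s" "t * s * t = t" "X n n * s * t = X n n"
    by (rule square_root_exists[of "X n n"]) (use XB herm nn in auto)
  \<comment> \<open>\<open>s * t\<close> is the support projection of the pivot \<open>X n n\<close>, so \<open>t * t\<close> is its
    pseudo-inverse and \<open>X'\<close> below is the Schur complement.\<close>
  define q where "q = 1 - s * t"
  have qB: "q \<in> B" unfolding q_def using st by auto
  have "s * t * (s * t) = s * t" using st(7) by (metis mult.assoc)
  then have q: "star q = q" "q * q = q" "X n n * q = 0"
    using st(3,4,8) st(6)[symmetric]
    by (simp_all add: q_def star_diff star_mult left_diff_distrib right_diff_distrib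
        flip: mult.assoc)
  have range: "s * t * X n j = X n j" if j: "j < n" for j
  proof -
    define v where "v i = (if i = j then 1 else 0 :: 'a)" for i
    have v: "v i \<in> B" for i by (simp add: v_def)
    have uv: "u v = X n j"
    proof -
      have "u v = (\<Sum>i<n. if i = j then X n j else 0)"
        unfolding u_def v_def by (rule sum.cong) auto
      then show ?thesis using j by simp
    qed
    define g where "g = Re (\<tau> (star (q * u v) * (q * u v)))"
    \<comment> \<open>In the direction \<open>q * u v\<close> the pivot term vanishes, since
      \<open>X n n * q = 0\<close>. The form is thus affine in \<open>r\<close>, and nonnegativity
      for all real \<open>r\<close> forces the slope to be zero.\<close>
    have le: "0 \<le> quadratic_form n X v - 2 * r * g" for r
    proof -
      define c where "c = - (r *\<^sub>R (q * u v))"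
      have cB: "c \<in> B" using v uB qB by (simp add: c_def)
      have "star c * u v = - (r *\<^sub>R (star (q * u v) * (q * u v)))"
        using q by (simp add: c_def star_scaleR star_mult mult.assoc) (metis mult.assoc)
      moreover have "star c * X n n * c = 0"
        using q by (simp add: c_def mult.assoc) (metis mult.assoc mult_zero_left mult_zero_right)
      ultimately show ?thesis
        using form[of v c, OF v cB] by (simp add: g_def minus scaleR)
    qed
    have "g = 0"
    proof (rule ccontr)
      assume "g \<noteq> 0"
      \<comment> \<open>At this \<open>r\<close> the affine expression equals -1.\<close>
      then show False
        using le[of "(quadratic_form n X v + 1) / (2 * g)"] by simp
    qed
    then have "q * X n j = 0" using faithful[of "q * u v"] by (simp add: g_def uv)
    then show ?thesis by (simp add: q_def left_diff_distrib)
  qed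
  define z where "z j = t * X n j" for j
  define X' where "X' i j = X i j - star (z i) * z j" for i j
  have "positive_matrix B n X'"
  proof (rule Suc.IH)
    show "X' i j \<in> B" if "i < n" "j < n" for i j
      using that XB st by (simp add: X'_def z_def)
    show "star (X' i j) = X' j i" if "i < n" "j < n" for i j
      using that herm by (simp add: X'_def star_diff star_mult star_star)
    fix v :: "nat \<Rightarrow> 'a" assume v: "\<And>i. v i \<in> B"
    \<comment> \<open>This choice of last coordinate completes the square, leaving exactly the form
      of the Schur complement.\<close>
    define c where "c = - (t * t * u v)"
    have cB: "c \<in> B" using v uB st by (simp add: c_def)
    have tu: "t * u v = (\<Sum>j<n. z j * v j)"
      by (simp add: u_def z_def sum_distrib_left mult.assoc)
    have w: "t * t * X n n * (t * t) = t * t"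
      using st(6,7) unfolding st(5)[symmetric] by (metis mult.assoc)
    have "star c * u v = - (star (t * u v) * (t * u v))"
      by (simp add: c_def star_mult st mult.assoc)
    moreover have "star c * X n n * c = star (u v) * (t * t * X n n * (t * t)) * u v"
      by (simp add: c_def star_mult st(3,4) mult.assoc)
    then have "star c * X n n * c = star (t * u v) * (t * u v)"
      unfolding w by (simp add: star_mult st(4) mult.assoc)
    ultimately have "0 \<le> quadratic_form n X v - Re (\<tau> (star (t * u v) * (t * u v)))"
      using form[of v c, OF v cB] by (simp add: minus)
    also have "star (t * u v) * (t * u v) = (\<Sum>i<n. \<Sum>j<n. star (v i) * (star (z i) * z j) * v j)"
      by (simp add: tu star_sum sum_product star_mult mult.assoc)
    also have "quadratic_form n X v - Re (\<tau> \<dots>) = quadratic_form n X' v"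
      by (simp add: quadratic_form_def X'_def right_diff_distrib left_diff_distrib sum_subtractf diff)
    finally show "0 \<le> quadratic_form n X' v" .
  qed
  then obtain Y' where Y': "\<And>i j. i < n \<Longrightarrow> j < n \<Longrightarrow> Y' i j \<in> B"
      "\<And>i j. i < n \<Longrightarrow> j < n \<Longrightarrow> X' i j = (\<Sum>k<n. star (Y' k i) * Y' k j)"
    unfolding positive_matrix_def by blast
  \<comment> \<open>The rows of \<open>Y\<close> are those of \<open>Y'\<close> padded with a zero
    last entry, followed by the row of all \<open>z j\<close> ending in \<open>s\<close>.\<close>
  define Y where "Y k j = (if k < n then if j < n then Y' k j else 0
      else if j < n then z j else s)" for k j
  have zs: "s * z j = X n j" if "j < n" for j
    using range[OF that] by (simp add: z_def mult.assoc)
  have "X i j = (\<Sum>k<Suc n. star (Y k i) * Y k j)" if ij: "i < Suc n" "j < Suc n" for i j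
  proof -
    consider "i < n" "j < n" | "i < n" "j = n" | "i = n" "j < n" | "i = n" "j = n"
      using ij by (metis less_SucE)
    then show ?thesis
    proof cases
      case 1
      then show ?thesis using Y'(2)[of i j] by (simp add: Y_def X'_def diff_eq_eq)
    next
      case 2
      have "star (z i) * s = star (s * z i)" by (simp add: star_mult st)
      then show ?thesis using 2 zs herm by (simp add: Y_def)
    next
      case 3
      then show ?thesis using zs by (simp add: Y_def st)
    next
      case 4
      then show ?thesis by (simp add: Y_def st)
    qed
  qed
  moreover have "Y i j \<in> B" if "i < Suc n" "j < Suc n" for i j
    using Y'(1) st XB by (simp add: Y_def z_def)
  ultimately show ?case unfolding positive_matrix_def by blast
qed

text \<open>The bimodule property moves the test vector \<open>v\<close> inside \<open>F\<close>,
  turning the form into a sum of \<open>\<tau> (F (star (w k) * w k))\<close>. Complete positivity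
  thus reduces to positivity under the trace.\<close>

lemma completely_positive_if_bimodule_map:
  assumes F: "Vector_Spaces.linear scaleC scaleC F" "\<And>x. F x \<in> B"
    and left: "\<And>b x. b \<in> B \<Longrightarrow> F (b * x) = b * F x"
    and right: "\<And>b x. b \<in> B \<Longrightarrow> F (x * b) = F x * b"
    and star: "\<And>x. F (star x) = star (F x)"
    and pos: "\<And>x. 0 \<le> Re (\<tau> (F (star x * x)))"
  shows "completely_positive UNIV B F"
  unfolding completely_positive_def
proof (intro allI impI)
  fix n and X :: "nat \<Rightarrow> nat \<Rightarrow> 'a" assume "positive_matrix UNIV n X"
  then obtain Y where Y: "\<And>i j. i < n \<Longrightarrow> j < n \<Longrightarrow> X i j = (\<Sum>k<n. star (Y k i) * Y k j)"
    unfolding positive_matrix_def by blast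
  interpret F: Vector_Spaces.linear scaleC scaleC F by (rule F)
  show "positive_matrix B n (\<lambda>i j. F (X i j))"
  proof (rule positive_matrix_if_quadratic_form_nonneg)
    show "F (X i j) \<in> B" for i j by (rule F)
    show "star (F (X i j)) = F (X j i)" if "i < n" "j < n" for i j
      using that by (simp add: Y star_sum star_mult star_star flip: star)
    fix v :: "nat \<Rightarrow> 'a" assume v: "\<And>i. v i \<in> B"
    define w where "w k = (\<Sum>j<n. Y k j * v j)" for k
    have "(\<Sum>i<n. \<Sum>j<n. star (v i) * F (X i j) * v j) =
        (\<Sum>i<n. \<Sum>j<n. F (star (v i) * X i j * v j))"
      using v by (simp add: left right)
    also have "\<dots> = (\<Sum>i<n. \<Sum>j<n. \<Sum>k<n. F (star (Y k i * v i) * (Y k j * v j)))"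
      by (simp add: Y sum_distrib_left sum_distrib_right star_mult mult.assoc F.sum)
    also have "\<dots> = (\<Sum>i<n. \<Sum>k<n. \<Sum>j<n. F (star (Y k i * v i) * (Y k j * v j)))"
      by (intro sum.cong refl sum.swap)
    also have "\<dots> = (\<Sum>k<n. \<Sum>i<n. \<Sum>j<n. F (star (Y k i * v i) * (Y k j * v j)))"
      by (rule sum.swap)
    also have "\<dots> = (\<Sum>k<n. F (star (w k) * w k))"
      by (simp add: w_def star_sum sum_product F.sum)
    finally show "0 \<le> quadratic_form n (\<lambda>i j. F (X i j)) v"
      by (simp add: quadratic_form_def sum pos sum_nonneg)
  qed
qed

section \<open>Conditional expectations\<close>

lemma conditional_expectation_bimodule:
  assumes E: "conditional_expectation B E" and b: "b \<in> B"
  shows "E (b * x) = b * E x" "E (x * b) = E x * b"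
proof -
  have *: "E (b * x) = b * E x \<and> E (star x) = star (E x)" if b: "b \<in> B" for b x
  proof -
    \<comment> \<open>In the factorization of the image of the Gram matrix of \<open>(1, b\<^sup>*, x)\<close>, the column of
      \<open>b\<^sup>*\<close> is that of \<open>1\<close> times \<open>b\<^sup>*\<close>, because \<open>E\<close> fixes \<open>b\<close>, \<open>b\<^sup>*\<close> and \<open>b b\<^sup>*\<close>.\<close>
    define u where "u i = (if i = 0 then 1 else if i = 1 then star b else x)" for i :: nat
    \<comment> \<open>A Gram matrix is positive by a factor whose only nonzero row is
      \<open>u\<close>.\<close>
    have "positive_matrix UNIV 3 (\<lambda>i j. star (u i) * u j)"
      unfolding positive_matrix_def
      by (intro exI[of _ "\<lambda>k i. if k = 0 then u i else 0"]) (simp add: numeral_3_eq_3)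
    then have "positive_matrix B 3 (\<lambda>i j. E (star (u i) * u j))"
      using E unfolding conditional_expectation_def completely_positive_def by blast
    then obtain Z :: "nat \<Rightarrow> nat \<Rightarrow> 'a" where "\<forall>i<3. \<forall>j<3. E (star (u i) * u j) = (\<Sum>k<3. star (Z k i) * Z k j)"
      unfolding positive_matrix_def by blast
    then have Z: "E (star (u i) * u j) = (\<Sum>k<3. star (Z k i) * Z k j)" if "i < 3" "j < 3" for i j
      using that by simp
    have EB: "E c = c" if "c \<in> B" for c
      using E that unfolding conditional_expectation_def by blast
    have G00: "(\<Sum>k<3. star (Z k 0) * Z k 0) = 1"
      using Z[of 0 0] by (simp add: u_def EB)
    have G01: "(\<Sum>k<3. star (Z k 0) * Z k 1) = star b"
      using Z[of 0 1] b by (simp add: u_def EB)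
    have G10: "(\<Sum>k<3. star (Z k 1) * Z k 0) = b"
      using Z[of 1 0] b by (simp add: u_def EB star_star)
    have G11: "(\<Sum>k<3. star (Z k 1) * Z k 1) = b * star b"
      using Z[of 1 1] b by (simp add: u_def EB star_star)
    have G02: "(\<Sum>k<3. star (Z k 0) * Z k 2) = E x"
      using Z[of 0 2] by (simp add: u_def)
    have G20: "(\<Sum>k<3. star (Z k 2) * Z k 0) = E (star x)"
      using Z[of 2 0] by (simp add: u_def)
    have G12: "(\<Sum>k<3. star (Z k 1) * Z k 2) = E (b * x)"
      using Z[of 1 2] by (simp add: u_def star_star)
    \<comment> \<open>The defect of the column relation; its Gram sum is \<open>b * star b\<close>
      taken with signs +, -, -, +, hence zero.\<close>
    define w where "w k = Z k 1 - Z k 0 * star b" for k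
    have "(\<Sum>k<3. star (w k) * w k) = (\<Sum>k<3. star (Z k 1) * Z k 1)
        - (\<Sum>k<3. star (Z k 1) * Z k 0) * star b - b * (\<Sum>k<3. star (Z k 0) * Z k 1)
        + b * (\<Sum>k<3. star (Z k 0) * Z k 0) * star b"
      by (simp add: w_def star_diff star_mult star_star sum_distrib_left sum_distrib_right
          sum.distrib sum_subtractf algebra_simps)
    also have "\<dots> = 0" by (simp only: G00 G01 G10 G11) simp
    finally have "w k = 0" if "k < 3" for k
      using sum_star_mult_self_eq_0[of "{..<3}" w k] that by simp
    then have "Z k 1 = Z k 0 * star b" if "k < 3" for k
      using that by (simp add: w_def)
    then have "(\<Sum>k<3. star (Z k 1) * Z k 2) = b * (\<Sum>k<3. star (Z k 0) * Z k 2)"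
      by (simp add: sum_distrib_left star_mult star_star mult.assoc)
    \<comment> \<open>The factorization is Hermitian: the adjoint of entry (0,2) is entry (2,0), so
      \<open>E\<close> preserves \<open>star\<close>.\<close>
    moreover have "star (\<Sum>k<3. star (Z k 0) * Z k 2) = (\<Sum>k<3. star (Z k 2) * Z k 0)"
      by (simp only: star_sum star_mult star_star)
    ultimately show ?thesis by (simp only: G02 G12 G20)
  qed
  show "E (b * x) = b * E x" using * b by blast
  \<comment> \<open>The right module property is the left one conjugated by
    \<open>star\<close>.\<close>
  have "E (star (x * b)) = star b * E (star x)"
    using *[of "star b" "star x"] b by (simp add: star_mult)
  then have "star (E (x * b)) = star (E x * b)"
    using *[OF b, of x] *[OF b, of "x * b"] by (simp add: star_mult)
  then show "E (x * b) = E x * b" by (metis star_star)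
qed

section \<open>The trace-preserving expectation\<close>

definition trace_expectation :: "'a \<Rightarrow> 'a" where
  "trace_expectation x = (SOME y. y \<in> B \<and> (\<forall>b\<in>B. \<tau> (b * y) = \<tau> (b * x)))"

text \<open>Since \<open>B\<close> is closed under \<open>star\<close>, orthogonality of
  \<open>x - y\<close> to \<open>B\<close> can be written without the star; this bilinear form suits
  the module arguments.\<close>

lemma trace_expectation_in_B: "trace_expectation x \<in> B"
  and trace_expectation_trace: "b \<in> B \<Longrightarrow> \<tau> (b * trace_expectation x) = \<tau> (b * x)"
proof -
  have "complex_vector.subspace B"
    using subalgebra by (simp add: unital_cstar_subalgebra_def)
  from orthogonal_projection_exists[OF fin_dim this, of x] obtain y where y: "y \<in> B"
    "\<And>b. b \<in> B \<Longrightarrow> \<tau> (star b * (x - y)) = 0" by blast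
  have "\<tau> (b * y) = \<tau> (b * x)" if "b \<in> B" for b
    using y(2)[of "star b"] that by (simp add: star_star right_diff_distrib diff)
  then have "\<exists>y. y \<in> B \<and> (\<forall>b\<in>B. \<tau> (b * y) = \<tau> (b * x))" using y(1) by blast
  from someI_ex[OF this] show "trace_expectation x \<in> B"
    "b \<in> B \<Longrightarrow> \<tau> (b * trace_expectation x) = \<tau> (b * x)"
    unfolding trace_expectation_def by blast+
qed

text \<open>The difference lies in \<open>B\<close> and is orthogonal to \<open>B\<close>, hence to
  itself. Algebraic identities for the expectation are then verified through the pairing
  alone.\<close>

lemma trace_expectation_unique:
  assumes "y \<in> B" "\<And>b. b \<in> B \<Longrightarrow> \<tau> (b * y) = \<tau> (b * x)"
  shows "trace_expectation x = y"
proof -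
  let ?d = "trace_expectation x - y"
  have "?d \<in> B" using assms(1) trace_expectation_in_B by simp
  then have "\<tau> (star ?d * ?d) = 0"
    using assms(2)[of "star ?d"] trace_expectation_trace[of "star ?d" x]
    by (simp add: right_diff_distrib[of "star ?d"] diff)
  then show ?thesis using faithful[of ?d] by simp
qed

lemma trace_expectation_linear: "Vector_Spaces.linear scaleC scaleC trace_expectation"
proof -
  have "trace_expectation (x + y) = trace_expectation x + trace_expectation y" for x y
    by (rule trace_expectation_unique)
      (simp_all add: trace_expectation_in_B trace_expectation_trace distrib_left add)
  moreover have "trace_expectation (c *\<^sub>C x) = c *\<^sub>C trace_expectation x" for c x
    by (rule trace_expectation_unique)
      (simp_all add: trace_expectation_in_B trace_expectation_trace mult_scaleC_right scaleC)
  ultimately show ?thesis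
    unfolding Vector_Spaces.linear_iff using complex_vector.vector_space_axioms by auto
qed

lemma trace_expectation_left:
  assumes "b \<in> B"
  shows "trace_expectation (b * x) = b * trace_expectation x"
proof (rule trace_expectation_unique)
  show "\<tau> (c * (b * trace_expectation x)) = \<tau> (c * (b * x))" if "c \<in> B" for c
    using trace_expectation_trace[of "c * b" x] assms that by (simp add: mult.assoc)
qed (simp add: assms trace_expectation_in_B)

lemma trace_expectation_right:
  assumes "b \<in> B"
  shows "trace_expectation (x * b) = trace_expectation x * b"
proof (rule trace_expectation_unique)
  \<comment> \<open>Traciality carries \<open>b\<close> to the front, where it joins
    \<open>c\<close> as the test element \<open>b * c\<close>.\<close>
  show "\<tau> (c * (trace_expectation x * b)) = \<tau> (c * (x * b))" if "c \<in> B" for c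
    using trace_expectation_trace[of "b * c" x] assms that
      commute[of "c * trace_expectation x" b] commute[of "c * x" b] by (simp add: mult.assoc)
qed (simp add: assms trace_expectation_in_B)

lemma trace_expectation_star: "trace_expectation (star x) = star (trace_expectation x)"
proof (rule trace_expectation_unique)
  show "\<tau> (b * star (trace_expectation x)) = \<tau> (b * star x)" if "b \<in> B" for b
    using trace_expectation_trace[of "star b" x] that commute[of b]
      star_swap[of "trace_expectation x" b] star_swap[of x b] by simp
qed (simp add: trace_expectation_in_B)

lemma trace_expectation_id: "b \<in> B \<Longrightarrow> trace_expectation b = b"
  by (rule trace_expectation_unique) auto

lemma trace_trace_expectation: "\<tau> (trace_expectation x) = \<tau> x"
  using trace_expectation_trace[of 1 x] by simp

lemma conditional_expectation_trace_expectation: "conditional_expectation B trace_expectation"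
proof -
  have "completely_positive UNIV B trace_expectation"
    by (rule completely_positive_if_bimodule_map)
      (simp_all add: trace_expectation_linear trace_expectation_in_B trace_expectation_left
        trace_expectation_right trace_expectation_star trace_trace_expectation nonneg)
  then show ?thesis
    unfolding conditional_expectation_def
    by (auto simp: trace_expectation_linear trace_expectation_in_B trace_expectation_id)
qed

section \<open>Uniqueness and the relative commutant\<close>

lemma conditional_expectation_unique:
  assumes comm: "relative_commutant B \<subseteq> B" and E: "conditional_expectation B E"
  shows "E = trace_expectation"
proof
  fix x
  interpret E: Vector_Spaces.linear scaleC scaleC E
    using E by (simp add: conditional_expectation_def)
  note bimod = conditional_expectation_bimodule[OF E]
  have EB: "E x \<in> B" "b \<in> B \<Longrightarrow> E b = b" for x b
    using E unfolding conditional_expectation_def by auto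
  obtain h where h: "\<And>x. \<tau> (E x) = \<tau> (h * x)"
    using riesz_representation[OF fin_dim, of "\<lambda>x. \<tau> (E x)"]
    by (auto simp: E.add E.scale add scaleC)
  have "h * b = b * h" if b: "b \<in> B" for b
  proof -
    \<comment> \<open>\<open>b\<close> passes through \<open>E\<close> by the bimodule property and
      around \<open>\<tau>\<close> by traciality, so \<open>h * b\<close> and \<open>b * h\<close>
      pair equally with every \<open>x\<close>.\<close>
    have "\<tau> ((h * b - b * h) * x) = 0" for x
    proof -
      have "\<tau> (h * b * x) = \<tau> (b * E x)" using h[of "b * x"] b by (simp add: bimod mult.assoc)
      also have "\<dots> = \<tau> (E (x * b))" using b by (simp add: bimod commute[of b])
      also have "\<dots> = \<tau> (b * h * x)"
        using h[of "x * b"] commute[of "h * x" b] by (simp add: mult.assoc)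
      finally show ?thesis by (simp add: left_diff_distrib diff)
    qed
    then show ?thesis using nondegenerate[of "h * b - b * h"] by simp
  qed
  then have hB: "h \<in> B" using comm unfolding relative_commutant_def by blast
  \<comment> \<open>\<open>E\<close> fixes \<open>star (h - 1)\<close>, so
    \<open>\<tau> (h * star (h - 1)) = \<tau> (star (h - 1))\<close>, and \<open>h - 1\<close> is
    orthogonal to itself.\<close>
  have "\<tau> (star (h - 1) * (h - 1)) = \<tau> (h * star (h - 1)) - \<tau> (star (h - 1))"
    using commute[of h] by (simp add: right_diff_distrib diff)
  also have "\<dots> = 0" using h[of "star (h - 1)"] hB by (simp add: EB)
  finally have h1: "h = 1" using faithful[of "h - 1"] by simp
  show "E x = trace_expectation x"
  proof (rule trace_expectation_unique[symmetric])
    show "\<tau> (b * E x) = \<tau> (b * x)" if "b \<in> B" for b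
      using h[of "b * x"] that by (simp add: h1 bimod)
  qed (rule EB)
qed

lemma selfadjoint_commutant_in_B:
  assumes uniq: "\<And>E. conditional_expectation B E \<Longrightarrow> E = trace_expectation"
    and a: "a \<in> relative_commutant B" "star a = a"
  shows "a \<in> B"
proof -
  define c where "c = a - trace_expectation a"
  have ab: "a * b = b * a" if "b \<in> B" for b
    using a that by (simp add: relative_commutant_def)
  have cb: "c * b = b * c" if "b \<in> B" for b
    using ab[OF that] trace_expectation_left[OF that, of a] trace_expectation_right[OF that, of a]
    by (simp add: c_def left_diff_distrib right_diff_distrib)
  have sc: "star c = c"
    using a trace_expectation_star[of a] by (simp add: c_def star_diff)
  interpret E0: Vector_Spaces.linear scaleC scaleC trace_expectation
    by (rule trace_expectation_linear)
  have Ec: "trace_expectation c = 0"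
    by (simp add: c_def E0.diff trace_expectation_id trace_expectation_in_B)
  \<comment> \<open>Centrality of \<open>c\<close> relative to \<open>B\<close> makes the
    expectation tracial against \<open>c\<close>; this is what lets the perturbed map preserve
    \<open>star\<close>.\<close>
  have Exc: "trace_expectation (x * c) = trace_expectation (c * x)" for x
  proof (rule trace_expectation_unique[OF trace_expectation_in_B])
    show "\<tau> (b * trace_expectation (c * x)) = \<tau> (b * (x * c))" if b: "b \<in> B" for b
      using trace_expectation_trace[OF b, of "c * x"] commute[of "b * x" c] cb[OF b]
      by (simp add: mult.assoc[symmetric])
  qed
  obtain \<Lambda> :: "real set" and e where fin: "finite \<Lambda>"
    and "\<And>l. l \<in> \<Lambda> \<Longrightarrow> e l \<noteq> 0" and e1: "\<And>l. l \<in> \<Lambda> \<Longrightarrow> star (e l) = e l"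
    and e2: "\<And>l m. l \<in> \<Lambda> \<Longrightarrow> m \<in> \<Lambda> \<Longrightarrow> e l * e m = (if l = m then e l else 0)"
    and one: "sum e \<Lambda> = 1" and ce: "c = (\<Sum>l\<in>\<Lambda>. l *\<^sub>R e l)"
    by (rule spectral_decomposition[OF fin_dim unital_cstar_subalgebra_UNIV sc UNIV_I]) blast
  \<comment> \<open>Small enough that \<open>1 + \<epsilon> * l\<close> is nonnegative for every
    eigenvalue \<open>l\<close> of \<open>c\<close>; the summand 1 keeps the denominator
    positive.\<close>
  define \<epsilon> where "\<epsilon> = 1 / (1 + (\<Sum>l\<in>\<Lambda>. \<bar>l\<bar>))"
  have S0: "0 \<le> (\<Sum>l\<in>\<Lambda>. \<bar>l\<bar>)" by (simp add: sum_nonneg)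
  then have eps: "\<epsilon> > 0" unfolding \<epsilon>_def by (intro divide_pos_pos) linarith+
  have eps_l: "0 \<le> 1 + \<epsilon> * l" if "l \<in> \<Lambda>" for l
  proof -
    have "\<bar>l\<bar> \<le> (\<Sum>l\<in>\<Lambda>. \<bar>l\<bar>)" using fin that by (intro member_le_sum) auto
    then have "\<epsilon> * \<bar>l\<bar> \<le> 1" using S0 by (simp add: \<epsilon>_def field_simps)
    moreover have "- (\<epsilon> * \<bar>l\<bar>) \<le> \<epsilon> * l" using eps by (simp add: abs_if)
    ultimately show ?thesis by linarith
  qed
  define F where "F x = trace_expectation x + \<epsilon> *\<^sub>R trace_expectation (c * x)" for x
  have pos: "0 \<le> Re (\<tau> (F (star x * x)))" for x
  proof -
    have "(\<Sum>l\<in>\<Lambda>. (1 + \<epsilon> * l) *\<^sub>R e l) = 1 + \<epsilon> *\<^sub>R c"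
      by (simp add: scaleR_left_distrib sum.distrib one ce scaleR_sum_right)
    then have "\<tau> (F (star x * x)) = \<tau> ((\<Sum>l\<in>\<Lambda>. (1 + \<epsilon> * l) *\<^sub>R e l) * (star x * x))"
      by (simp add: F_def add scaleR trace_trace_expectation distrib_right)
    also have "\<dots> = (\<Sum>l\<in>\<Lambda>. complex_of_real (1 + \<epsilon> * l) * \<tau> (star (x * e l) * (x * e l)))"
      unfolding sum_distrib_right sum
    \<comment> \<open>Doubling the idempotent \<open>e l\<close> and cycling one copy under
      \<open>\<tau>\<close> turns each term into a nonnegative multiple of a square.\<close>
    proof (rule sum.cong)
      fix l assume l: "l \<in> \<Lambda>"
      have "\<tau> (e l * (star x * x)) = \<tau> (e l * (e l * (star x * x)))"
        using e2[OF l l] by (simp flip: mult.assoc)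
      also have "\<dots> = \<tau> (star (x * e l) * (x * e l))"
        using commute[of "e l"] e1[OF l] by (simp add: star_mult mult.assoc)
      finally show "\<tau> ((1 + \<epsilon> * l) *\<^sub>R e l * (star x * x)) =
          complex_of_real (1 + \<epsilon> * l) * \<tau> (star (x * e l) * (x * e l))"
        by (simp add: scaleR)
    qed simp
    finally show ?thesis by (simp add: sum_nonneg eps_l nonneg)
  qed
  have F_left: "F (b * x) = b * F x" if b: "b \<in> B" for b x
  proof -
    have "c * (b * x) = b * (c * x)" using cb[OF b] by (metis mult.assoc)
    then show ?thesis by (simp add: F_def trace_expectation_left[OF b] distrib_left)
  qed
  have F_right: "F (x * b) = F x * b" if b: "b \<in> B" for b x
    by (simp add: F_def trace_expectation_right[OF b] distrib_right flip: mult.assoc)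
  have F_star: "F (star x) = star (F x)" for x
    using Exc[of "star x"]
    by (simp add: F_def star_add star_scaleR star_mult sc flip: trace_expectation_star)
  have F_linear: "Vector_Spaces.linear scaleC scaleC F"
    unfolding Vector_Spaces.linear_iff
    using complex_vector.vector_space_axioms
    by (auto simp: F_def E0.add E0.scale distrib_left mult_scaleC_right scaleR_scaleC
        scaleC_add_right scaleC_scaleC mult.commute)
  \<comment> \<open>\<open>F b = b * F 1\<close>, and \<open>F 1 = 1\<close> because the expectation
    annihilates \<open>c\<close>.\<close>
  have "F b = b" if b: "b \<in> B" for b
    using F_left[OF b, of 1] by (simp add: F_def Ec trace_expectation_id)
  moreover have F_in: "F x \<in> B" for x by (simp add: F_def trace_expectation_in_B)
  moreover have "completely_positive UNIV B F"
    by (rule completely_positive_if_bimodule_map) (fact F_linear F_in F_left F_right F_star pos)+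
  ultimately have "conditional_expectation B F"
    unfolding conditional_expectation_def using F_linear by auto
  then have F_eq: "F = trace_expectation" by (rule uniq)
  \<comment> \<open>Equality of the two maps forces the expectation of \<open>c * x\<close> to
    vanish; since it preserves \<open>\<tau>\<close>, \<open>c\<close> pairs to zero with
    everything.\<close>
  have "\<tau> (c * x) = 0" for x
  proof -
    have "F x = trace_expectation x" by (simp add: F_eq)
    then have "trace_expectation (c * x) = 0" using eps by (simp add: F_def)
    then show ?thesis using trace_trace_expectation[of "c * x"] by simp
  qed
  then have "c = 0" by (rule nondegenerate)
  then show ?thesis using trace_expectation_in_B[of a] by (simp add: c_def)
qed

end

theorem proposition3p6:
  fixes B :: "'a::cstar_algebra set"
  assumes "finite_dimensional_algebra TYPE('a)"
    and "unital_cstar_subalgebra B"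
  shows "relative_commutant B \<subseteq> B \<longleftrightarrow> (\<exists>!E. conditional_expectation B E)"
proof -
  obtain \<tau> :: "'a \<Rightarrow> complex" where \<tau>: "faithful_trace \<tau>"
    using faithful_trace_exists[OF assms(1)] by blast
  interpret faithful_trace_inclusion \<tau> B
    using \<tau> assms by (simp add: faithful_trace_inclusion_def faithful_trace_inclusion_axioms_def)
  show ?thesis
  proof
    assume "relative_commutant B \<subseteq> B"
    then show "\<exists>!E. conditional_expectation B E"
      using conditional_expectation_trace_expectation conditional_expectation_unique by blast
  next
    assume "\<exists>!E. conditional_expectation B E"
    then have uniq: "\<And>E. conditional_expectation B E \<Longrightarrow> E = trace_expectation"
      using conditional_expectation_trace_expectation by blast
    show "relative_commutant B \<subseteq> B"
    proof
      fix x assume x: "x \<in> relative_commutant B"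
      \<comment> \<open>Both Cartesian parts of \<open>x\<close> involve \<open>star x\<close>, so
        it must commute with \<open>B\<close> too before the self-adjoint case applies.\<close>
      have sx: "star x \<in> relative_commutant B"
        unfolding relative_commutant_def
      proof (intro CollectI ballI)
        fix b assume "b \<in> B"
        then have "x * star b = star b * x" using x by (simp add: relative_commutant_def)
        then have "star (x * star b) = star (star b * x)" by simp
        then show "star x * b = b * star x" by (simp add: star_mult star_star)
      qed
      obtain a b where ab: "star a = a" "star b = b" "x = a + \<i> *\<^sub>C b"
        "a = (1/2) *\<^sub>C (x + star x)" "b = (- \<i> / 2) *\<^sub>C (x - star x)"
        by (rule cartesian_decomposition)
      have "a \<in> relative_commutant B" "b \<in> relative_commutant B"
        using x sx unfolding ab(4,5) relative_commutant_def
        by (simp_all add: mult_scaleC_left mult_scaleC_right distrib_left distrib_right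
            left_diff_distrib right_diff_distrib)
      then show "x \<in> B"
        unfolding ab(3) using selfadjoint_commutant_in_B[OF uniq] ab(1,2) by blast
    qed
  qed
qed

end
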